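(* Let $d\geq 2$ and $n\geq 1$ be integers, and let $M\subset[n]^d$ be a subset containing two or zero elements in every layer. Then $M$ is non-basic if and only if there exist a non-empty subset $K\subset M$ and a coloring of the elements of $K$ in two colors such that every layer contains the same number of elements of $K$ of each color.
   Context: Notation: $[n]=\{1,\ldots,n\}$; $K\subset M$ allows $K=M$. A finite subset $M\subset\mathbb{R}^d$ (in particular, a subset $M\subset[n]^d$) is called basic if for any function $f\colon M\to\mathbb{R}$ there exist functions $f_1,\ldots,f_d\colon\mathbb{R}\to\mathbb{R}$ such that $f(x_1,\ldots,x_d)=f_1(x_1)+\ldots+f_d(x_d)$ for every $(x_1,\ldots,x_d)\in M$; otherwise it is non-basic. A layer of $[n]^d$ is a hyperplane given by an equation $x_i=j$ with $i\in[d]$, $j\in[n]$. *)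

theory Defs
  imports "HOL-Analysis.Finite_Cartesian_Product"
begin

text \<open>The dimension d is CARD('d); coordinates are indexed by the finite type 'd.
  Functions on M are represented by total functions, of which only the values on M matter.
  The definition is meant for finite M, and is not restricted to finite M so that its
  negation means non-basic.\<close>

definition basic :: "(real ^ 'd) set \<Rightarrow> bool" where
  "basic M \<longleftrightarrow>
     (\<forall>f :: real ^ 'd \<Rightarrow> real. \<exists>F :: 'd \<Rightarrow> real \<Rightarrow> real.
        \<forall>x\<in>M. f x = (\<Sum>i\<in>UNIV. F i (x $ i)))"

definition grid :: "nat \<Rightarrow> (real ^ 'd) set" where
  "grid n = {x. \<forall>i. x $ i \<in> real ` {1..n}}"

definition layers :: "nat \<Rightarrow> (real ^ 'd) set set" where
  "layers n = {{x. x $ i = real j} | i j. j \<in> {1..n}}"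

end

theory Submission
  imports Defs
begin

text \<open>Call a function \<open>f\<close> separable on \<open>M\<close> if it agrees on \<open>M\<close> with a sum of functions of one
  coordinate each. The separable functions form a vector space containing the indicator of every
  layer, and \<open>M\<close> is basic if and only if every function is separable on \<open>M\<close>.

  If a coloring balances every layer, the corresponding signs \<open>\<plusminus>1\<close> on \<open>K\<close> are orthogonal to every
  separable function, because the sum over \<open>K\<close> can be taken layer by layer. The signs are not
  orthogonal to themselves, so no separable function restricts to them
  (\<open>separable_orthogonal_to_balanced\<close>, \<open>balanced_coloring_imp_not_basic\<close>).

  Conversely, work modulo separable functions and write \<open>\<delta>\<^sub>x\<close> for the indicator of a point \<open>x\<close>.
  A layer meeting \<open>M\<close> in exactly \<open>y\<close> and \<open>z\<close> gives \<open>\<delta>\<^sub>z \<equiv> -\<delta>\<^sub>y\<close>. If \<open>M\<close> is finite and non-basic, then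
  some \<open>\<delta>\<^sub>a\<close> is not separable. Let \<open>K\<close> be the set of points \<open>x\<close> of \<open>M\<close> with \<open>\<delta>\<^sub>x \<equiv> \<delta>\<^sub>a\<close> or \<open>\<delta>\<^sub>x \<equiv> -\<delta>\<^sub>a\<close>,
  colored according to the sign. The sign is well defined, since \<open>2 \<delta>\<^sub>a\<close> is not separable, and each
  layer meets \<open>K\<close> either in no point or in two points of opposite signs. Working in the quotient
  replaces the walks in the graph on \<open>M\<close> in which points of a common layer are adjacent: \<open>K\<close>
  contains the component of \<open>a\<close>, which is bipartite (\<open>nonbasic_imp_balanced_coloring\<close>).\<close>

section \<open>Separable functions\<close>

definition separable_on :: "(real ^ 'd) set \<Rightarrow> (real ^ 'd \<Rightarrow> real) \<Rightarrow> bool" where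
  "separable_on M f \<longleftrightarrow> (\<exists>F :: 'd \<Rightarrow> real \<Rightarrow> real. \<forall>x\<in>M. f x = (\<Sum>i\<in>UNIV. F i (x $ i)))"

lemma basic_iff_separable: "basic M \<longleftrightarrow> (\<forall>f. separable_on M f)"
  by (simp add: basic_def separable_on_def)

lemma separable_on_cong:
  assumes "separable_on M f" and "\<And>x. x \<in> M \<Longrightarrow> f x = g x"
  shows "separable_on M g"
  using assms by (auto simp: separable_on_def)

lemma separable_on_subset:
  assumes "separable_on M f" and "K \<subseteq> M"
  shows "separable_on K f"
  using assms unfolding separable_on_def by blast

lemma separable_on_zero: "separable_on M (\<lambda>_. 0)"
  unfolding separable_on_def by (rule exI[of _ "\<lambda>_ _. 0"]) simp

lemma separable_on_add:
  assumes "separable_on M f" and "separable_on M g"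
  shows "separable_on M (\<lambda>x. f x + g x)"
proof -
  obtain F G where "\<forall>x\<in>M. f x = (\<Sum>i\<in>UNIV. F i (x $ i))" "\<forall>x\<in>M. g x = (\<Sum>i\<in>UNIV. G i (x $ i))"
    using assms by (auto simp: separable_on_def)
  then show ?thesis
    unfolding separable_on_def by (intro exI[of _ "\<lambda>i t. F i t + G i t"]) (simp add: sum.distrib)
qed

lemma separable_on_scale:
  assumes "separable_on M f"
  shows "separable_on M (\<lambda>x. a * f x)"
proof -
  obtain F where "\<forall>x\<in>M. f x = (\<Sum>i\<in>UNIV. F i (x $ i))"
    using assms by (auto simp: separable_on_def)
  then show ?thesis
    unfolding separable_on_def by (intro exI[of _ "\<lambda>i t. a * F i t"]) (simp add: sum_distrib_left)
qed

lemma separable_on_diff: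
  assumes "separable_on M f" and "separable_on M g"
  shows "separable_on M (\<lambda>x. f x - g x)"
  using separable_on_add[OF assms(1) separable_on_scale[OF assms(2), of "-1"]] by simp

lemma separable_on_sum:
  assumes "\<And>y. y \<in> A \<Longrightarrow> separable_on M (f y)"
  shows "separable_on M (\<lambda>x. \<Sum>y\<in>A. f y x)"
  using assms
  by (induction A rule: infinite_finite_induct) (auto intro: separable_on_zero separable_on_add)

lemma separable_on_layer_indicator: "separable_on M (\<lambda>x. of_bool (x $ i = t))"
proof -
  have "of_bool (x $ i = t) = (\<Sum>k\<in>UNIV. if k = i then of_bool (x $ k = t) else 0)"
    for x :: "real ^ 'a"
    by simp
  then show ?thesis
    unfolding separable_on_def
    by (intro exI[of _ "\<lambda>k s. if k = i then of_bool (s = t) else 0"]) simp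
qed

abbreviation point_indicator :: "'a \<Rightarrow> 'a \<Rightarrow> real" where
  "point_indicator y \<equiv> (\<lambda>x. of_bool (x = y))"

text \<open>On a finite set every function is a linear combination of point indicators.\<close>

lemma basicI_point_indicators:
  assumes "finite M" and "\<And>y. y \<in> M \<Longrightarrow> separable_on M (point_indicator y)"
  shows "basic M"
  unfolding basic_iff_separable
proof
  fix f
  have "separable_on M (\<lambda>x. \<Sum>y\<in>M. f y * point_indicator y x)"
    using assms(2) by (intro separable_on_sum separable_on_scale)
  then show "separable_on M f"
  proof (rule separable_on_cong)
    fix x assume "x \<in> M"
    then show "(\<Sum>y\<in>M. f y * point_indicator y x) = f x"
      using \<open>finite M\<close> by (simp add: of_bool_def if_distrib cong: if_cong)
  qed
qed

text \<open>This gives the relation \<open>\<delta>\<^sub>z \<equiv> -\<delta>\<^sub>y\<close> modulo separable functions: on \<open>M\<close> the sum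
  of the two indicators is the indicator of a layer.\<close>

lemma separable_on_pair_indicator:
  assumes "M \<inter> {x. x $ i = t} = {y, z}" and "y \<noteq> z"
  shows "separable_on M (\<lambda>x. point_indicator y x + point_indicator z x)"
  using separable_on_layer_indicator[of M i t]
proof (rule separable_on_cong)
  fix x assume "x \<in> M"
  then have "x $ i = t \<longleftrightarrow> x = y \<or> x = z"
    using assms(1) by auto
  then show "of_bool (x $ i = t) = point_indicator y x + point_indicator z x"
    using assms(2) by auto
qed

section \<open>A balanced coloring obstructs separability\<close>

lemma finite_grid: "finite (grid n :: (real ^ 'd) set)"
proof (rule finite_imageD)
  have "vec_nth ` (grid n :: (real ^ 'd) set) \<subseteq> PiE UNIV (\<lambda>_. real ` {1..n})"
    by (auto simp: grid_def)
  then show "finite (vec_nth ` (grid n :: (real ^ 'd) set))"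
    by (rule finite_subset) (intro finite_PiE, auto)
  show "inj_on vec_nth (grid n :: (real ^ 'd) set)"
    by (auto simp: inj_on_def vec_nth_inject)
qed

abbreviation balanced :: "nat \<Rightarrow> (real ^ 'd) set \<Rightarrow> (real ^ 'd \<Rightarrow> bool) \<Rightarrow> bool" where
  "balanced n K c \<equiv>
    (\<forall>L \<in> layers n. card {x \<in> K \<inter> L. c x = True} = card {x \<in> K \<inter> L. c x = False})"

lemma sum_signs:
  assumes "finite A"
  shows "(\<Sum>x\<in>A. if c x then 1 else - 1 :: real) = card {x \<in> A. c x} - real (card {x \<in> A. \<not> c x})"
  using assms by (simp add: sum.If_cases Int_def Collect_neg_eq[symmetric])

text \<open>A balanced layer has sign sum zero. A summand \<open>F i (x $ i)\<close> of a separable function is constant on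
  every layer orthogonal to direction \<open>i\<close>, and these layers partition \<open>K\<close>, so each summand contributes
  zero.\<close>

lemma separable_orthogonal_to_balanced:
  fixes K :: "(real ^ 'd) set"
  assumes "K \<subseteq> grid n" and "balanced n K c" and "separable_on K f"
  shows "(\<Sum>x\<in>K. (if c x then 1 else - 1) * f x) = 0"
proof -
  let ?s = "\<lambda>x. if c x then 1 else - 1 :: real"
  have fin: "finite K"
    using assms(1) finite_grid finite_subset by blast
  obtain F where F: "\<forall>x\<in>K. f x = (\<Sum>i\<in>UNIV. F i (x $ i))"
    using assms(3) by (auto simp: separable_on_def)
  have layer_sum: "(\<Sum>x \<in> {x \<in> K. x $ i = real j}. ?s x) = 0" if "j \<in> {1..n}" for i j
  proof -
    have "{x. x $ i = real j} \<in> layers n"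
      using that by (auto simp: layers_def)
    with assms(2) have "card {x \<in> K \<inter> {x. x $ i = real j}. c x = True}
      = card {x \<in> K \<inter> {x. x $ i = real j}. c x = False}"
      by blast
    then show ?thesis
      using fin by (simp add: sum_signs)
  qed
  have "(\<Sum>x\<in>K. ?s x * F i (x $ i)) = 0" for i
  proof -
    have "(\<Sum>x\<in>K. ?s x * F i (x $ i))
      = (\<Sum>t \<in> real ` {1..n}. \<Sum>x \<in> {x \<in> K. x $ i = t}. ?s x * F i (x $ i))"
      using assms(1) fin by (intro sum.group[symmetric]) (auto simp: grid_def)
    also have "\<dots> = (\<Sum>t \<in> real ` {1..n}. (\<Sum>x \<in> {x \<in> K. x $ i = t}. ?s x) * F i t)"
      by (intro sum.cong refl) (simp add: sum_distrib_right)
    also have "\<dots> = 0"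
      using layer_sum by (intro sum.neutral) auto
    finally show ?thesis .
  qed
  moreover have "(\<Sum>x\<in>K. ?s x * f x) = (\<Sum>i\<in>UNIV. \<Sum>x\<in>K. ?s x * F i (x $ i))"
    using F by (subst sum.swap) (simp add: sum_distrib_left)
  ultimately show ?thesis
    by simp
qed

lemma balanced_coloring_imp_not_basic:
  fixes M :: "(real ^ 'd) set"
  assumes "M \<subseteq> grid n" and "K \<subseteq> M" and "K \<noteq> {}" and "balanced n K c"
  shows "\<not> basic M"
proof
  let ?s = "\<lambda>x. if c x then 1 else - 1 :: real"
  assume "basic M"
  then have "separable_on M ?s"
    by (simp add: basic_iff_separable)
  then have "separable_on K ?s"
    using assms(2) by (rule separable_on_subset)
  then have "(\<Sum>x\<in>K. ?s x * ?s x) = 0"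
    using assms by (intro separable_orthogonal_to_balanced) auto
  moreover have "(\<Sum>x\<in>K. ?s x * ?s x) = (\<Sum>x\<in>K. 1)"
    by (intro sum.cong) auto
  moreover have "finite K"
    using assms finite_grid finite_subset by metis
  ultimately show False
    using assms(3) by simp
qed

section \<open>A balanced coloring of a non-basic set\<close>

text \<open>Modulo separable functions, \<open>P\<close> and \<open>N\<close> below single out the points whose indicator is congruent to
  plus or minus a fixed point indicator that is not separable. They are mutually exclusive, and passing to
  the other point of a common layer exchanges them, so \<open>P\<close> is a balanced coloring of the points
  satisfying \<open>P\<close> or \<open>N\<close>.\<close>

lemma nonbasic_imp_balanced_coloring:
  fixes M :: "(real ^ 'd) set"
  assumes "finite M" and "\<not> basic M"
    and "\<And>L. L \<in> layers n \<Longrightarrow> card (M \<inter> L) = 2 \<or> M \<inter> L = {}"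
  shows "\<exists>K c. K \<subseteq> M \<and> K \<noteq> {} \<and> balanced n K c"
proof -
  obtain a where "a \<in> M" and a: "\<not> separable_on M (point_indicator a)"
    using basicI_point_indicators assms(1,2) by blast
  define P where "P x \<longleftrightarrow> separable_on M (\<lambda>u. point_indicator x u - point_indicator a u)" for x
  define N where "N x \<longleftrightarrow> separable_on M (\<lambda>u. point_indicator x u + point_indicator a u)" for x
  have excl: "\<not> (P x \<and> N x)" for x
  proof
    assume "P x \<and> N x"
    \<comment> \<open>Half the difference of the two functions is the indicator of \<open>a\<close>.\<close>
    then have "separable_on M (\<lambda>u. 1 / 2 *
        ((point_indicator x u + point_indicator a u) - (point_indicator x u - point_indicator a u)))"
      unfolding P_def N_def by (elim conjE) (rule separable_on_scale[OF separable_on_diff])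
    then show False
      using a by simp
  qed
  have flip: "(P y \<longrightarrow> N z) \<and> (N y \<longrightarrow> P z)"
    if "separable_on M (\<lambda>u. point_indicator y u + point_indicator z u)" for y z
    using separable_on_diff[OF that, of "\<lambda>u. point_indicator y u - point_indicator a u"]
      separable_on_diff[OF that, of "\<lambda>u. point_indicator y u + point_indicator a u"]
    by (simp add: P_def N_def algebra_simps)
  define K where "K = {x \<in> M. P x \<or> N x}"
  have "P a"
    by (simp add: P_def separable_on_zero)
  then have "a \<in> K"
    using \<open>a \<in> M\<close> by (simp add: K_def)
  have "balanced n K P"
  proof
    fix L :: "(real ^ 'd) set"
    assume L: "L \<in> layers n"
    then obtain i j where L_eq: "L = {x. x $ i = real j}"
      by (auto simp: layers_def)
    show "card {x \<in> K \<inter> L. P x = True} = card {x \<in> K \<inter> L. P x = False}"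
    proof (cases "M \<inter> L = {}")
      case True
      then have "K \<inter> L = {}"
        by (auto simp: K_def)
      then show ?thesis
        by simp
    next
      case False
      then obtain y z where yz: "M \<inter> L = {y, z}" "y \<noteq> z"
        using assms(3)[OF L] by (auto simp: card_2_iff)
      have "separable_on M (\<lambda>u. point_indicator y u + point_indicator z u)"
        using separable_on_pair_indicator yz unfolding L_eq by blast
      then have "P y \<longleftrightarrow> N z" "P z \<longleftrightarrow> N y"
        using flip[of y z] flip[of z y] by (auto simp: add.commute)
      moreover have "{x \<in> K \<inter> L. P x = True} = {x \<in> {y, z}. P x}"
        "{x \<in> K \<inter> L. P x = False} = {x \<in> {y, z}. N x}"
        using excl yz(1) by (auto simp: K_def)
      moreover have "{x \<in> {y, z}. Q x} = (if Q y then {y} else {}) \<union> (if Q z then {z} else {})" for Q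
        by auto
      ultimately show ?thesis
        using yz(2) by simp
    qed
  qed
  then show ?thesis
    using \<open>a \<in> K\<close> by (intro exI[of _ K] exI[of _ P]) (auto simp: K_def)
qed

theorem theorem1p3:
  fixes n :: nat and M :: "(real ^ 'd) set"
  assumes "CARD('d) \<ge> 2"
    and "n \<ge> 1"
    and "M \<subseteq> grid n"
    and "\<And>L. L \<in> layers n \<Longrightarrow> card (M \<inter> L) = 2 \<or> card (M \<inter> L) = 0"
  shows "\<not> basic M \<longleftrightarrow>
    (\<exists>K c. K \<subseteq> M \<and> K \<noteq> {} \<and>
      (\<forall>L \<in> layers n. card {x \<in> K \<inter> L. c x = True} = card {x \<in> K \<inter> L. c x = False}))"
proof
  have fin: "finite M"
    using assms(3) finite_grid finite_subset by blast
  assume "\<not> basic M"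
  moreover have "card (M \<inter> L) = 2 \<or> M \<inter> L = {}" if "L \<in> layers n" for L
    using assms(4)[OF that] fin by simp
  ultimately show "\<exists>K c. K \<subseteq> M \<and> K \<noteq> {} \<and> balanced n K c"
    using nonbasic_imp_balanced_coloring fin by blast
next
  assume "\<exists>K c. K \<subseteq> M \<and> K \<noteq> {} \<and> balanced n K c"
  then show "\<not> basic M"
    using balanced_coloring_imp_not_basic[OF assms(3)] by blast
qed

end
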